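(* For any system $\Sigma$ determined by matrices $A,B,C,D$ there exists a maximal solution $(\Pi_{\max},H_{\max},\Lambda_{\max})$ of the equation $$\begin{bmatrix}A&B\\C&D\end{bmatrix}\begin{bmatrix}\Pi_{\max}\\H_{\max}\end{bmatrix}=\begin{bmatrix}\Pi_{\max}\Lambda_{\max}\\0\end{bmatrix}$$ in the sense that $\operatorname{Im}\Pi_{\max}\supset\operatorname{Im}\Pi_1$ whenever $(\Pi_1,H_1,\Lambda_1)$ is any other solution of this equation. Moreover, for this maximal solution $\mathcal V^*(\Sigma)=\operatorname{Im}\Pi_{\max}$.
   Context: $A\in\mathbb C^{n\times n}$, $B\in\mathbb C^{n\times q}$, $C\in\mathbb C^{p\times n}$, $D\in\mathbb C^{p\times q}$; solutions $(\Pi,H,\Lambda)$ have $\Pi\in\mathbb C^{n\times m}$, $H\in\mathbb C^{q\times m}$, $\Lambda\in\mathbb C^{m\times m}$ with arbitrary $m$. $\mathcal V^*(\Sigma)$ is the maximal output-nulling controlled-invariant subspace: the largest subspace $\mathcal V\subset\mathbb C^n$ for which there is a feedback matrix $K$ with $(A+BK)\mathcal V\subset\mathcal V\subset\ker(C+DK)$. *)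

theory Defs
  imports "Jordan_Normal_Form.Matrix_Kernel"
begin

definition mat_image :: "complex mat \<Rightarrow> complex vec set" where
  "mat_image M = (\<lambda>v. M *\<^sub>v v) ` carrier_vec (dim_col M)"

text \<open>The sizes \<open>n\<close>, \<open>q\<close>, \<open>p\<close> are read off the system matrices as
  \<open>dim_row A\<close>, \<open>dim_col B\<close>, \<open>dim_row C\<close>. The number \<open>m\<close> of columns belongs to the
  solution, so different solutions may have different \<open>m\<close>; \<open>m = 0\<close> is allowed, and then
  the image is the zero subspace.\<close>

definition is_solution ::
  "complex mat \<Rightarrow> complex mat \<Rightarrow> complex mat \<Rightarrow> complex mat
    \<Rightarrow> complex mat \<times> complex mat \<times> complex mat \<Rightarrow> bool" where
  "is_solution A B C D = (\<lambda>(P, H, L). \<exists>m.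
     P \<in> carrier_mat (dim_row A) m \<and> H \<in> carrier_mat (dim_col B) m \<and> L \<in> carrier_mat m m \<and>
     four_block_mat A B C D * (P @\<^sub>r H) = (P * L) @\<^sub>r 0\<^sub>m (dim_row C) m)"

definition is_maximal_solution ::
  "complex mat \<Rightarrow> complex mat \<Rightarrow> complex mat \<Rightarrow> complex mat
    \<Rightarrow> complex mat \<times> complex mat \<times> complex mat \<Rightarrow> bool" where
  "is_maximal_solution A B C D = (\<lambda>(P, H, L). is_solution A B C D (P, H, L) \<and>
     (\<forall>P1 H1 L1. is_solution A B C D (P1, H1, L1) \<longrightarrow> mat_image P1 \<subseteq> mat_image P))"

definition output_nulling ::
  "complex mat \<Rightarrow> complex mat \<Rightarrow> complex mat \<Rightarrow> complex mat \<Rightarrow> complex vec set \<Rightarrow> bool" where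
  "output_nulling A B C D V \<longleftrightarrow>
     VectorSpace.subspace class_ring V (module_vec TYPE(complex) (dim_row A)) \<and>
     (\<exists>K \<in> carrier_mat (dim_col B) (dim_row A).
        (\<lambda>v. (A + B * K) *\<^sub>v v) ` V \<subseteq> V \<and> V \<subseteq> mat_kernel (C + D * K))"

text \<open>\<open>is_Vstar A B C D V\<close> stands for the equation \<open>\<V>\<^sup>*(\<Sigma>) = V\<close>. It is a predicate rather than
  a description operator, so that asserting it includes the existence of the largest
  output-nulling subspace; uniqueness is immediate by antisymmetry.\<close>

definition is_Vstar ::
  "complex mat \<Rightarrow> complex mat \<Rightarrow> complex mat \<Rightarrow> complex mat \<Rightarrow> complex vec set \<Rightarrow> bool" where
  "is_Vstar A B C D V \<longleftrightarrow>
     output_nulling A B C D V \<and> (\<forall>W. output_nulling A B C D W \<longrightarrow> W \<subseteq> V)"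

end

theory Submission
  imports Defs
begin

text \<open>The existence of the greatest subspace and the existence of a feedback pull in different
  directions: subspaces that are output-nulling for different feedbacks \<open>K\<close> have no obvious common
  feedback on their sum. The proof therefore goes through a weaker notion without feedback:
  a subspace \<open>V\<close> is weakly output-nulling if every state \<open>v \<in> V\<close> admits \<^emph>\<open>some\<close> input \<open>h\<close> with
  \<open>A v + B h \<in> V\<close> and \<open>C v + D h = 0\<close>. This notion is stable under sums (add the inputs), so the
  union of all weakly output-nulling subspaces is again one, and it is the greatest.

  Solutions \<open>(\<Pi>, H, \<Lambda>)\<close> are the same data in coordinates. If \<open>(\<Pi>, H, \<Lambda>)\<close> is a solution, then
  \<open>H u\<close> is a suitable input for the state \<open>\<Pi> u\<close> (\<open>weakly_output_nulling_solution_image\<close>). Conversely,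
  a weakly output-nulling subspace is the image of some matrix \<open>\<Pi>\<close>, and inputs for the columns of
  \<open>\<Pi>\<close>, together with coordinates of the successor states with respect to these columns, are the
  columns of \<open>H\<close> and \<open>\<Lambda>\<close> (\<open>solution_of_weakly_output_nulling\<close>). Hence the greatest weakly
  output-nulling subspace is the image of a maximal solution.

  The feedback is recovered only at the end (\<open>output_nulling_solution_image\<close>). The input \<open>H u\<close>
  depends on \<open>u\<close> and not just on the state \<open>\<Pi> u\<close>; choosing \<open>u\<close> linearly in the state, as
  \<open>u = X v\<close> with a generalized inverse \<open>X\<close> of \<open>\<Pi>\<close>, gives \<open>K = H X\<close>. So images of solutions are
  output-nulling, and since output-nulling subspaces are weakly output-nulling, the image of a
  maximal solution is the greatest output-nulling subspace.\<close>

section \<open>Images, subspaces and generalized inverses of matrices\<close>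

abbreviation subspace_vec :: "nat \<Rightarrow> complex vec set \<Rightarrow> bool" where
  "subspace_vec n V \<equiv> VectorSpace.subspace class_ring V (module_vec TYPE(complex) n)"

lemma subspace_vec_iff:
  "subspace_vec n V \<longleftrightarrow> V \<subseteq> carrier_vec n \<and> 0\<^sub>v n \<in> V \<and>
     (\<forall>v\<in>V. \<forall>w\<in>V. v + w \<in> V) \<and> (\<forall>c. \<forall>v\<in>V. c \<cdot>\<^sub>v v \<in> V)"
  using vec_vs[of n, where 'a = complex] vec_module[of n, where 'a = complex]
  unfolding subspace_def submodule_def
  by (auto simp: module_vec_simps class_ring_simps)

lemma mem_mat_image_iff: "M \<in> carrier_mat n m \<Longrightarrow> v \<in> mat_image M \<longleftrightarrow> (\<exists>u\<in>carrier_vec m. v = M *\<^sub>v u)"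
  unfolding mat_image_def by auto

lemma subspace_vec_mat_image:
  assumes M: "M \<in> carrier_mat n m"
  shows "subspace_vec n (mat_image M)"
  unfolding subspace_vec_iff
proof (intro conjI ballI allI subsetI)
  fix v assume "v \<in> mat_image M"
  then show "v \<in> carrier_vec n" using M unfolding mem_mat_image_iff[OF M] by auto
next
  show "0\<^sub>v n \<in> mat_image M" unfolding mem_mat_image_iff[OF M]
    using M by (intro bexI[of _ "0\<^sub>v m"]) auto
next
  fix v w assume "v \<in> mat_image M" "w \<in> mat_image M"
  then obtain x y where "x \<in> carrier_vec m" "y \<in> carrier_vec m" "v = M *\<^sub>v x" "w = M *\<^sub>v y"
    unfolding mem_mat_image_iff[OF M] by auto
  then show "v + w \<in> mat_image M" unfolding mem_mat_image_iff[OF M]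
    using M by (intro bexI[of _ "x + y"]) (auto simp: mult_add_distrib_mat_vec)
next
  fix c v assume "v \<in> mat_image M"
  then obtain x where "x \<in> carrier_vec m" "v = M *\<^sub>v x"
    unfolding mem_mat_image_iff[OF M] by auto
  then show "c \<cdot>\<^sub>v v \<in> mat_image M" unfolding mem_mat_image_iff[OF M]
    using M by (intro bexI[of _ "c \<cdot>\<^sub>v x"]) auto
qed

text \<open>The columns of \<open>P\<close> are a maximal linearly independent subset of \<open>W\<close>; its cardinality is bounded
  by the dimension \<open>n\<close>, and any further vector of \<open>W\<close> is dependent on it.\<close>

lemma subspace_vec_eq_mat_image:
  assumes W: "subspace_vec n W"
  shows "\<exists>m. \<exists>P \<in> carrier_mat n m. mat_image P = W \<and> (\<forall>j<m. col P j \<in> W)"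
proof -
  interpret vec_space "TYPE(complex)" n .
  have Wc: "W \<subseteq> carrier_vec n" using W unfolding subspace_vec_iff by auto
  have subm: "submodule class_ring W V" using W unfolding subspace_def by auto
  obtain S where "finite S" and max: "maximal S (\<lambda>S. S \<subseteq> W \<and> lin_indpt S)"
  proof (atomize_elim, rule maximal_exists)
    fix S assume "S \<subseteq> W \<and> lin_indpt S"
    then show "finite S \<and> card S \<le> dim" using li_le_dim[OF fin_dim, of S] Wc by auto
  next
    show "{} \<subseteq> W \<and> lin_indpt {}" by (simp add: finite_lin_indpt2)
  qed
  then have SW: "S \<subseteq> W" and li: "lin_indpt S" unfolding maximal_def by auto
  have span: "span S = W"
  proof
    show "span S \<subseteq> W" by (rule span_is_subset[OF SW subm])
    show "W \<subseteq> span S"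
    proof
      fix w assume w: "w \<in> W"
      show "w \<in> span S"
      proof (cases "w \<in> S")
        case True
        then show ?thesis using in_own_span[of S] SW Wc by auto
      next
        case False
        have "lin_dep (S \<union> {w})"
        proof (rule ccontr)
          assume "\<not> ?thesis"
          then have "S \<union> {w} = S" using max w SW unfolding maximal_def by blast
          with False show False by auto
        qed
        then show ?thesis using lin_dep_iff_in_span[of S w] li SW Wc w False by auto
      qed
    qed
  qed
  obtain ws where ws: "set ws = S" using \<open>finite S\<close> finite_list by auto
  define P where "P = mat_of_cols n ws"
  have P: "P \<in> carrier_mat n (length ws)" unfolding P_def by simp
  have cols: "cols P = ws" unfolding P_def using ws SW Wc by (intro cols_mat_of_cols) auto
  have "mat_image P = col_space P"
    unfolding col_space_eq[OF P] mat_image_def using P by auto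
  also have "\<dots> = W" unfolding col_space_def cols ws span ..
  finally have "mat_image P = W" .
  moreover have "col P j \<in> W" if "j < length ws" for j
    using that cols ws SW P by (metis carrier_matD(2) cols_nth nth_mem subsetD)
  ultimately show ?thesis using P by blast
qed

text \<open>Let \<open>E = Q P\<close> be the reduced row echelon form, with \<open>Q\<close> invertible. The matrix \<open>S\<close> that sends
  the \<open>j\<close>-th unit vector to the unit vector at the pivot column of row \<open>j\<close> (and to \<open>0\<close> if row \<open>j\<close> has
  no pivot) makes \<open>E S\<close> the projection onto the pivot rows. As the other rows of \<open>E\<close> vanish,
  \<open>E S E = E\<close>, and undoing \<open>Q\<close> shows that \<open>S Q\<close> is a generalized inverse of \<open>P\<close>.\<close>

lemma ex_generalized_inverse:
  fixes P :: "'a :: field mat"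
  assumes P: "P \<in> carrier_mat n m"
  shows "\<exists>X \<in> carrier_mat m n. P * X * P = P"
proof -
  define E where "E = gauss_jordan_single P"
  note gj = gauss_jordan_single[OF P E_def[symmetric]]
  have E: "E \<in> carrier_mat n m" by (rule gj(2))
  obtain Q R where EQ: "E = Q * P" and Q: "Q \<in> carrier_mat n n" and R: "R \<in> carrier_mat n n"
    and RQ: "R * Q = 1\<^sub>m n" using gj(4) by auto
  obtain f where f: "pivot_fun E f m" using gj(3) E unfolding row_echelon_form_def by auto
  have dE: "dim_row E = n" using E by auto
  note piv = pivot_funD[OF dE f]
  \<comment> \<open>A row without a pivot has \<open>f j = m\<close>, which is no row index of \<open>S\<close>, so column \<open>j\<close> is zero.\<close>
  define S :: "'a mat" where "S = mat m n (\<lambda>(k, j). if k = f j then 1 else 0)"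
  have S: "S \<in> carrier_mat m n" unfolding S_def by simp
  have ES: "(E * S) $$ (i, j) = (if i = j \<and> f j < m then 1 else 0)" if ij: "i < n" "j < n" for i j
  proof -
    have "(E * S) $$ (i, j) = (\<Sum>k<m. E $$ (i, k) * (if k = f j then 1 else 0))"
      using ij E S by (simp add: scalar_prod_def S_def lessThan_atLeast0)
    also have "\<dots> = (\<Sum>k<m. if k = f j then E $$ (i, k) else 0)" by (intro sum.cong) auto
    also have "\<dots> = (if f j < m then E $$ (i, f j) else 0)" by (simp add: sum.delta)
    also have "\<dots> = (if i = j \<and> f j < m then 1 else 0)"
      using piv(4,5) ij by auto
    finally show ?thesis .
  qed
  have ESE: "E * S * E = E"
  proof (rule eq_matI)
    fix i k assume "i < dim_row E" "k < dim_col E"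
    then have ik: "i < n" "k < m" using E by auto
    have "(E * S * E) $$ (i, k) = (\<Sum>j<n. (E * S) $$ (i, j) * E $$ (j, k))"
      using ik E mult_carrier_mat[OF E S]
      by (subst index_mult_mat) (auto simp: scalar_prod_def lessThan_atLeast0 simp del: index_mult_mat(1))
    also have "\<dots> = (\<Sum>j<n. if j = i then (if f i < m then E $$ (i, k) else 0) else 0)"
      using ik by (intro sum.cong) (auto simp: ES)
    also have "\<dots> = (if f i < m then E $$ (i, k) else 0)" using ik by simp
    also have "\<dots> = E $$ (i, k)" using piv(1)[OF ik(1)] piv(2)[OF ik(1), of k] ik by auto
    finally show "(E * S * E) $$ (i, k) = E $$ (i, k)" .
  qed (use E in auto)
  have RE: "R * E = P"
    unfolding EQ using assoc_mult_mat[OF R Q P] RQ P by simp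
  have SQ: "S * Q \<in> carrier_mat m n" using S Q by simp
  have "P * (S * Q) * P = R * E * (S * Q * P)"
    unfolding RE by (rule assoc_mult_mat[OF P SQ P])
  also have "S * Q * P = S * E" unfolding EQ by (rule assoc_mult_mat[OF S Q P])
  also have "R * E * (S * E) = R * (E * (S * E))" using R E S by (intro assoc_mult_mat) auto
  also have "E * (S * E) = E" using ESE assoc_mult_mat[OF E S E] by simp
  also note RE
  finally show ?thesis using S Q by (intro bexI[of _ "S * Q"]) auto
qed

section \<open>Solutions of the matrix equation\<close>

context
  fixes A B C D :: "complex mat" and n p q :: nat
  assumes A: "A \<in> carrier_mat n n" and B: "B \<in> carrier_mat n q"
    and C: "C \<in> carrier_mat p n" and D: "D \<in> carrier_mat p q"
begin

lemma col_linear_combination: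
  assumes M: "M \<in> carrier_mat k n" and X: "X \<in> carrier_mat n m"
    and N: "N \<in> carrier_mat k q" and Y: "Y \<in> carrier_mat q m" and j: "j < m"
  shows "col (M * X + N * Y) j = M *\<^sub>v col X j + N *\<^sub>v col Y j"
  using assms by (intro eq_vecI) auto

lemma is_solution_iff:
  "is_solution A B C D (P, H, L) \<longleftrightarrow>
    (\<exists>m. P \<in> carrier_mat n m \<and> H \<in> carrier_mat q m \<and> L \<in> carrier_mat m m \<and>
      A * P + B * H = P * L \<and> C * P + D * H = 0\<^sub>m p m)"
proof -
  have "four_block_mat A B C D * (P @\<^sub>r H) = (P * L) @\<^sub>r 0\<^sub>m p m \<longleftrightarrow>
      A * P + B * H = P * L \<and> C * P + D * H = 0\<^sub>m p m"
    if P: "P \<in> carrier_mat n m" and H: "H \<in> carrier_mat q m" and L: "L \<in> carrier_mat m m" for m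
  proof -
    have "four_block_mat A B C D * (P @\<^sub>r H) = (A * P + B * H) @\<^sub>r (C * P + D * H)"
    proof -
      have "four_block_mat A B C D * (P @\<^sub>r H) = four_block_mat (A * P + B * H)
         (A * 0\<^sub>m n 0 + B * 0\<^sub>m q 0) (C * P + D * H) (C * 0\<^sub>m n 0 + D * 0\<^sub>m q 0)"
        unfolding append_rows_def using P H
        by (simp add: mult_four_block_mat[OF A B C D P _ H, of "0\<^sub>m n 0" 0 "0\<^sub>m q 0"])
      also have "A * 0\<^sub>m n 0 + B * 0\<^sub>m q 0 = 0\<^sub>m n 0" using A B by auto
      also have "C * 0\<^sub>m n 0 + D * 0\<^sub>m q 0 = 0\<^sub>m p 0" using C D by auto
      finally show ?thesis unfolding append_rows_def using A B C D P H by simp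
    qed
    moreover have "X @\<^sub>r Y = X' @\<^sub>r Y' \<longleftrightarrow> X = X' \<and> Y = Y'"
      if c: "X \<in> carrier_mat n m" "X' \<in> carrier_mat n m" "Y \<in> carrier_mat p m" "Y' \<in> carrier_mat p m"
      for X X' Y Y' :: "complex mat"
    proof
      assume e: "X @\<^sub>r Y = X' @\<^sub>r Y'"
      have ix: "X $$ (i, j) = X' $$ (i, j)" if "i < n" "j < m" for i j
        using that c arg_cong[OF e, of "\<lambda>M. M $$ (i, j)"] by (simp add: append_rows_def)
      have iy: "Y $$ (i, j) = Y' $$ (i, j)" if "i < p" "j < m" for i j
        using that c arg_cong[OF e, of "\<lambda>M. M $$ (n + i, j)"] by (simp add: append_rows_def)
      show "X = X' \<and> Y = Y'" using ix iy c by (auto intro!: eq_matI)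
    qed simp
    ultimately show ?thesis using A B C D P H L by simp
  qed
  then show ?thesis unfolding is_solution_def using A B C by auto
qed

lemma solution_mult_vec:
  assumes P: "P \<in> carrier_mat n m" and H: "H \<in> carrier_mat q m" and L: "L \<in> carrier_mat m m"
    and eq: "A * P + B * H = P * L" "C * P + D * H = 0\<^sub>m p m" and u: "u \<in> carrier_vec m"
  shows "A *\<^sub>v (P *\<^sub>v u) + B *\<^sub>v (H *\<^sub>v u) = P *\<^sub>v (L *\<^sub>v u)"
    and "C *\<^sub>v (P *\<^sub>v u) + D *\<^sub>v (H *\<^sub>v u) = 0\<^sub>v p"
proof -
  have "A *\<^sub>v (P *\<^sub>v u) + B *\<^sub>v (H *\<^sub>v u) = (A * P + B * H) *\<^sub>v u"
    using A B P H u by (simp add: add_mult_distrib_mat_vec[of _ n m])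
  also have "\<dots> = P *\<^sub>v (L *\<^sub>v u)" unfolding eq using P L u by simp
  finally show "A *\<^sub>v (P *\<^sub>v u) + B *\<^sub>v (H *\<^sub>v u) = P *\<^sub>v (L *\<^sub>v u)" .
  have "C *\<^sub>v (P *\<^sub>v u) + D *\<^sub>v (H *\<^sub>v u) = (C * P + D * H) *\<^sub>v u"
    using C D P H u by (simp add: add_mult_distrib_mat_vec[of _ p m])
  also have "\<dots> = 0\<^sub>v p" unfolding eq using u by (intro eq_vecI) auto
  finally show "C *\<^sub>v (P *\<^sub>v u) + D *\<^sub>v (H *\<^sub>v u) = 0\<^sub>v p" .
qed

section \<open>Output-nulling subspaces with a free choice of input\<close>

text \<open>The input \<open>h\<close> may depend on \<open>v\<close> in an arbitrary way; this is what makes the notion visibly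
  stable under sums.\<close>

definition weakly_output_nulling :: "complex vec set \<Rightarrow> bool" where
  "weakly_output_nulling V \<longleftrightarrow> subspace_vec n V \<and>
     (\<forall>v\<in>V. \<exists>h\<in>carrier_vec q. A *\<^sub>v v + B *\<^sub>v h \<in> V \<and> C *\<^sub>v v + D *\<^sub>v h = 0\<^sub>v p)"

lemma weakly_output_nulling_solution_image:
  assumes "is_solution A B C D (P, H, L)"
  shows "weakly_output_nulling (mat_image P)"
proof -
  obtain m where P: "P \<in> carrier_mat n m" and H: "H \<in> carrier_mat q m" and L: "L \<in> carrier_mat m m"
    and eq: "A * P + B * H = P * L" "C * P + D * H = 0\<^sub>m p m"
    using assms unfolding is_solution_iff by blast
  note sol = solution_mult_vec[OF P H L eq]
  have "\<exists>h\<in>carrier_vec q. A *\<^sub>v v + B *\<^sub>v h \<in> mat_image P \<and> C *\<^sub>v v + D *\<^sub>v h = 0\<^sub>v p"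
    if "v \<in> mat_image P" for v
  proof -
    obtain u where "u \<in> carrier_vec m" "v = P *\<^sub>v u" using \<open>v \<in> mat_image P\<close> unfolding mem_mat_image_iff[OF P] by blast
    then show ?thesis using sol H L
      by (intro bexI[of _ "H *\<^sub>v u"]) (auto simp: mem_mat_image_iff[OF P])
  qed
  then show ?thesis unfolding weakly_output_nulling_def using subspace_vec_mat_image[OF P] by blast
qed

text \<open>By linearity it is enough to satisfy the two equations on the columns of a matrix \<open>P\<close> with
  image \<open>W\<close>, and there the inputs and the coordinates of the successor states can be chosen one
  column at a time.\<close>

lemma solution_of_weakly_output_nulling:
  assumes W: "weakly_output_nulling W"
  shows "\<exists>P H L. is_solution A B C D (P, H, L) \<and> mat_image P = W"
proof -
  obtain m P where P: "P \<in> carrier_mat n m" and im: "mat_image P = W" and cW: "\<forall>j<m. col P j \<in> W"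
    using subspace_vec_eq_mat_image W unfolding weakly_output_nulling_def by blast
  have "\<exists>h l. h \<in> carrier_vec q \<and> l \<in> carrier_vec m \<and>
      A *\<^sub>v col P j + B *\<^sub>v h = P *\<^sub>v l \<and> C *\<^sub>v col P j + D *\<^sub>v h = 0\<^sub>v p" if "j < m" for j
  proof -
    have "col P j \<in> W" using cW \<open>j < m\<close> by blast
    then obtain h where "h \<in> carrier_vec q" "C *\<^sub>v col P j + D *\<^sub>v h = 0\<^sub>v p"
      and "A *\<^sub>v col P j + B *\<^sub>v h \<in> mat_image P"
      using W unfolding weakly_output_nulling_def im by blast
    then show ?thesis unfolding mem_mat_image_iff[OF P] by blast
  qed
  then obtain h l where hl: "\<And>j. j < m \<Longrightarrow> h j \<in> carrier_vec q" "\<And>j. j < m \<Longrightarrow> l j \<in> carrier_vec m"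
    "\<And>j. j < m \<Longrightarrow> A *\<^sub>v col P j + B *\<^sub>v h j = P *\<^sub>v l j"
    "\<And>j. j < m \<Longrightarrow> C *\<^sub>v col P j + D *\<^sub>v h j = 0\<^sub>v p" by metis
  define H where "H = mat_of_cols q (map h [0..<m])"
  define L where "L = mat_of_cols m (map l [0..<m])"
  have H: "H \<in> carrier_mat q m" and L: "L \<in> carrier_mat m m" unfolding H_def L_def by auto
  have colH: "col H j = h j" and colL: "col L j = l j" if "j < m" for j
    using that hl(1,2) unfolding H_def L_def by auto
  have "A * P + B * H = P * L"
  proof (rule mat_col_eqI)
    fix j assume "j < dim_col (P * L)"
    then have j: "j < m" using L by auto
    have "col (A * P + B * H) j = A *\<^sub>v col P j + B *\<^sub>v col H j"
      by (rule col_linear_combination[OF A P B H j])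
    also have "\<dots> = col (P * L) j" 
      using col_mult2[OF P L j] hl(3)[OF j] by (simp only: colH[OF j] colL[OF j])
    finally show "col (A * P + B * H) j = col (P * L) j" .
  qed (use A B P H L in auto)
  moreover have "C * P + D * H = 0\<^sub>m p m"
  proof (rule mat_col_eqI)
    fix j assume "j < dim_col (0\<^sub>m p m :: complex mat)"
    then have j: "j < m" by auto
    have "col (C * P + D * H) j = C *\<^sub>v col P j + D *\<^sub>v col H j"
      by (rule col_linear_combination[OF C P D H j])
    also have "\<dots> = col (0\<^sub>m p m) j" using j hl(4) by (simp add: colH)
    finally show "col (C * P + D * H) j = col (0\<^sub>m p m) j" .
  qed (use C D P H in auto)
  ultimately show ?thesis using P H L im unfolding is_solution_iff by blast
qed

lemma weakly_output_nulling_sum: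
  assumes V: "weakly_output_nulling V" and W: "weakly_output_nulling W"
  shows "weakly_output_nulling {v + w | v w. v \<in> V \<and> w \<in> W}"
proof -
  let ?S = "{v + w | v w. v \<in> V \<and> w \<in> W}"
  have sV: "V \<subseteq> carrier_vec n" "0\<^sub>v n \<in> V" "\<And>x y. x \<in> V \<Longrightarrow> y \<in> V \<Longrightarrow> x + y \<in> V"
      "\<And>c x. x \<in> V \<Longrightarrow> c \<cdot>\<^sub>v x \<in> V"
    and sW: "W \<subseteq> carrier_vec n" "0\<^sub>v n \<in> W" "\<And>x y. x \<in> W \<Longrightarrow> y \<in> W \<Longrightarrow> x + y \<in> W"
      "\<And>c x. x \<in> W \<Longrightarrow> c \<cdot>\<^sub>v x \<in> W"
    using V W unfolding weakly_output_nulling_def subspace_vec_iff by auto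
  have swap: "(a + b) + (c + d) = (a + c) + (b + d)"
    if "a \<in> carrier_vec k" "b \<in> carrier_vec k" "c \<in> carrier_vec k" "d \<in> carrier_vec k"
    for a b c d :: "complex vec" and k
    using that by (intro eq_vecI) auto
  have "subspace_vec n ?S" unfolding subspace_vec_iff
  proof (intro conjI ballI allI)
    show "?S \<subseteq> carrier_vec n" using sV(1) sW(1) by (auto intro: add_carrier_vec)
    show "0\<^sub>v n \<in> ?S" using sV(2) sW(2) by force
  next
    fix x y assume "x \<in> ?S" "y \<in> ?S"
    then obtain v w v' w' where xy: "x = v + w" "y = v' + w'"
      and mem: "v \<in> V" "w \<in> W" "v' \<in> V" "w' \<in> W" by auto
    have "x + y = (v + v') + (w + w')"
      unfolding xy using mem sV(1) sW(1) by (intro swap[of _ n]) auto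
    moreover have "v + v' \<in> V" "w + w' \<in> W" using mem sV(3) sW(3) by auto
    ultimately show "x + y \<in> ?S" by blast
  next
    fix c x assume "x \<in> ?S"
    then obtain v w where x: "x = v + w" and v: "v \<in> V" and w: "w \<in> W" by auto
    have "c \<cdot>\<^sub>v x = c \<cdot>\<^sub>v v + c \<cdot>\<^sub>v w"
      unfolding x using v w sV(1) sW(1) by (intro smult_add_distrib_vec) auto
    moreover have "c \<cdot>\<^sub>v v \<in> V" "c \<cdot>\<^sub>v w \<in> W" using v w sV(4) sW(4) by auto
    ultimately show "c \<cdot>\<^sub>v x \<in> ?S" by blast
  qed
  moreover have "\<exists>h\<in>carrier_vec q. A *\<^sub>v x + B *\<^sub>v h \<in> ?S \<and> C *\<^sub>v x + D *\<^sub>v h = 0\<^sub>v p"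
    if "x \<in> ?S" for x
  proof -
    obtain v w where x: "x = v + w" and v: "v \<in> V" and w: "w \<in> W" using \<open>x \<in> ?S\<close> by auto
    have vc: "v \<in> carrier_vec n" and wc: "w \<in> carrier_vec n" using v w sV sW by auto
    obtain h where h: "h \<in> carrier_vec q" "A *\<^sub>v v + B *\<^sub>v h \<in> V" "C *\<^sub>v v + D *\<^sub>v h = 0\<^sub>v p"
      using V v unfolding weakly_output_nulling_def by blast
    obtain g where g: "g \<in> carrier_vec q" "A *\<^sub>v w + B *\<^sub>v g \<in> W" "C *\<^sub>v w + D *\<^sub>v g = 0\<^sub>v p"
      using W w unfolding weakly_output_nulling_def by blast
    have split: "M *\<^sub>v x + N *\<^sub>v (h + g) = (M *\<^sub>v v + N *\<^sub>v h) + (M *\<^sub>v w + N *\<^sub>v g)"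
      if M: "M \<in> carrier_mat k n" and N: "N \<in> carrier_mat k q" for M N k
    proof -
      have "M *\<^sub>v x + N *\<^sub>v (h + g) = (M *\<^sub>v v + M *\<^sub>v w) + (N *\<^sub>v h + N *\<^sub>v g)"
        unfolding x using M N vc wc h g by (simp add: mult_add_distrib_mat_vec)
      also have "\<dots> = (M *\<^sub>v v + N *\<^sub>v h) + (M *\<^sub>v w + N *\<^sub>v g)"
        using M N vc wc h g by (intro swap[of _ k]) auto
      finally show ?thesis .
    qed
    have "A *\<^sub>v x + B *\<^sub>v (h + g) \<in> ?S" using split[OF A B] h g by blast
    moreover have "C *\<^sub>v x + D *\<^sub>v (h + g) = 0\<^sub>v p" using split[OF C D] h g by simp
    ultimately show ?thesis using h g by (intro bexI[of _ "h + g"]) auto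
  qed
  ultimately show ?thesis unfolding weakly_output_nulling_def by blast
qed

lemma weakly_output_nulling_zero: "weakly_output_nulling {0\<^sub>v n}"
proof -
  have "subspace_vec n {0\<^sub>v n}" unfolding subspace_vec_iff by (auto intro: eq_vecI)
  moreover have "A *\<^sub>v 0\<^sub>v n + B *\<^sub>v 0\<^sub>v q \<in> {0\<^sub>v n}"
    using A B by (auto intro!: eq_vecI)
  moreover have "C *\<^sub>v 0\<^sub>v n + D *\<^sub>v 0\<^sub>v q = 0\<^sub>v p"
    using C D by (auto intro!: eq_vecI)
  moreover have "0\<^sub>v q \<in> carrier_vec q" by simp
  ultimately show ?thesis unfolding weakly_output_nulling_def by blast
qed

text \<open>The union is closed under addition because two members of the family both lie in their sum,
  which belongs to the family.\<close>

lemma weakly_output_nulling_Union: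
  "weakly_output_nulling (\<Union>{V. weakly_output_nulling V})"
proof -
  let ?U = "\<Union>{V. weakly_output_nulling V}"
  have sub: "V \<subseteq> carrier_vec n" "0\<^sub>v n \<in> V" "\<And>c v. v \<in> V \<Longrightarrow> c \<cdot>\<^sub>v v \<in> V"
    if "weakly_output_nulling V" for V
    using that unfolding weakly_output_nulling_def subspace_vec_iff by blast+
  have "subspace_vec n ?U" unfolding subspace_vec_iff
  proof (intro conjI ballI allI)
    show "?U \<subseteq> carrier_vec n" using sub(1) by blast
    show "0\<^sub>v n \<in> ?U" using weakly_output_nulling_zero by blast
    show "v + w \<in> ?U" if "v \<in> ?U" "w \<in> ?U" for v w
      using that weakly_output_nulling_sum by blast
    show "c \<cdot>\<^sub>v v \<in> ?U" if "v \<in> ?U" for c v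
      using that sub(3) by blast
  qed
  moreover have "\<exists>h\<in>carrier_vec q. A *\<^sub>v v + B *\<^sub>v h \<in> ?U \<and> C *\<^sub>v v + D *\<^sub>v h = 0\<^sub>v p"
    if "v \<in> ?U" for v
  proof -
    obtain V where V: "weakly_output_nulling V" "v \<in> V" using \<open>v \<in> ?U\<close> by blast
    then obtain h where "h \<in> carrier_vec q" "A *\<^sub>v v + B *\<^sub>v h \<in> V" "C *\<^sub>v v + D *\<^sub>v h = 0\<^sub>v p"
      unfolding weakly_output_nulling_def by blast
    with V show ?thesis by blast
  qed
  ultimately show ?thesis unfolding weakly_output_nulling_def by blast
qed

section \<open>Output-nulling subspaces with feedback\<close>

lemma feedback_mult_vec:
  assumes "M \<in> carrier_mat k n" "N \<in> carrier_mat k q" "K \<in> carrier_mat q n" "v \<in> carrier_vec n"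
  shows "(M + N * K) *\<^sub>v v = M *\<^sub>v v + N *\<^sub>v (K *\<^sub>v v)"
  using assms by (simp add: add_mult_distrib_mat_vec[of _ k n])

lemma weakly_output_nulling_if_output_nulling:
  assumes V: "output_nulling A B C D V"
  shows "weakly_output_nulling V"
proof -
  obtain K where sub: "subspace_vec n V" and K: "K \<in> carrier_mat q n"
    and inv: "(\<lambda>v. (A + B * K) *\<^sub>v v) ` V \<subseteq> V" and ker: "V \<subseteq> mat_kernel (C + D * K)"
    using V A B unfolding output_nulling_def by auto
  have CK: "C + D * K \<in> carrier_mat p n" using C D K by auto
  have "\<exists>h\<in>carrier_vec q. A *\<^sub>v v + B *\<^sub>v h \<in> V \<and> C *\<^sub>v v + D *\<^sub>v h = 0\<^sub>v p" if v: "v \<in> V" for v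
  proof (intro bexI conjI)
    have vc: "v \<in> carrier_vec n" using sub v unfolding subspace_vec_iff by auto
    show "K *\<^sub>v v \<in> carrier_vec q" using K vc by auto
    show "A *\<^sub>v v + B *\<^sub>v (K *\<^sub>v v) \<in> V"
      using inv v feedback_mult_vec[OF A B K vc] by auto
    show "C *\<^sub>v v + D *\<^sub>v (K *\<^sub>v v) = 0\<^sub>v p"
      using mat_kernelD(2)[OF CK, of v] ker v feedback_mult_vec[OF C D K vc] by auto
  qed
  then show ?thesis unfolding weakly_output_nulling_def using sub by blast
qed

text \<open>For \<open>v\<close> in the image of \<open>P\<close>, the vector \<open>u = X v\<close> satisfies \<open>v = P u\<close>, so the feedback \<open>K = H X\<close>
  produces the input \<open>H u\<close>, for which the solution equations give \<open>A v + B K v = P (L u)\<close> and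
  \<open>C v + D K v = 0\<close>.\<close>

lemma output_nulling_solution_image:
  assumes "is_solution A B C D (P, H, L)"
  shows "output_nulling A B C D (mat_image P)"
proof -
  obtain m where P: "P \<in> carrier_mat n m" and H: "H \<in> carrier_mat q m" and L: "L \<in> carrier_mat m m"
    and eq: "A * P + B * H = P * L" "C * P + D * H = 0\<^sub>m p m"
    using assms unfolding is_solution_iff by blast
  note sol = solution_mult_vec[OF P H L eq]
  obtain X where X: "X \<in> carrier_mat m n" and PXP: "P * X * P = P"
    using ex_generalized_inverse[OF P] by blast
  define K where "K = H * X"
  have K: "K \<in> carrier_mat q n" unfolding K_def using H X by auto
  have CK: "C + D * K \<in> carrier_mat p n" using C D K by auto
  have key: "v \<in> carrier_vec n \<and> (A + B * K) *\<^sub>v v \<in> mat_image P \<and> (C + D * K) *\<^sub>v v = 0\<^sub>v p"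
    if "v \<in> mat_image P" for v
  proof -
    obtain w where w: "w \<in> carrier_vec m" and vw: "v = P *\<^sub>v w"
      using \<open>v \<in> mat_image P\<close> unfolding mem_mat_image_iff[OF P] by blast
    have v: "v \<in> carrier_vec n" unfolding vw using P w by auto
    define u where "u = X *\<^sub>v v"
    have u: "u \<in> carrier_vec m" unfolding u_def using X v by auto
    have vu: "v = P *\<^sub>v u"
    proof -
      have "(P * X * P) *\<^sub>v w = (P * X) *\<^sub>v v"
        unfolding vw using P X w by (intro assoc_mult_mat_vec) auto
      also have "\<dots> = P *\<^sub>v u"
        unfolding u_def using P X v by (intro assoc_mult_mat_vec) auto
      finally show ?thesis unfolding PXP vw .
    qed
    have Kv: "K *\<^sub>v v = H *\<^sub>v u" unfolding K_def u_def using H X v by simp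
    show ?thesis
      unfolding feedback_mult_vec[OF A B K v] feedback_mult_vec[OF C D K v] Kv
      using sol[OF u] L u v by (auto simp: vu[symmetric] mem_mat_image_iff[OF P])
  qed
  show ?thesis unfolding output_nulling_def
  proof (intro conjI bexI)
    show "VectorSpace.subspace class_ring (mat_image P) (module_vec TYPE(complex) (dim_row A))"
      using subspace_vec_mat_image[OF P] A by simp
    show "K \<in> carrier_mat (dim_col B) (dim_row A)" using K A B by simp
    show "(\<lambda>v. (A + B * K) *\<^sub>v v) ` mat_image P \<subseteq> mat_image P" using key by auto
    show "mat_image P \<subseteq> mat_kernel (C + D * K)" using key mat_kernelI[OF CK] by auto
  qed
qed

section \<open>Maximal solutions\<close>

lemma ex_maximal_solution: "\<exists>P H L. is_maximal_solution A B C D (P, H, L)"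
proof -
  obtain P H L where sol: "is_solution A B C D (P, H, L)"
    and im: "mat_image P = \<Union>{V. weakly_output_nulling V}"
    using solution_of_weakly_output_nulling[OF weakly_output_nulling_Union] by blast
  have "mat_image P1 \<subseteq> mat_image P" if "is_solution A B C D (P1, H1, L1)" for P1 H1 L1
    unfolding im using weakly_output_nulling_solution_image[OF that] by blast
  then have "is_maximal_solution A B C D (P, H, L)"
    unfolding is_maximal_solution_def using sol by blast
  then show ?thesis by blast
qed

lemma is_Vstar_maximal_solution_image:
  assumes max: "is_maximal_solution A B C D (P, H, L)"
  shows "is_Vstar A B C D (mat_image P)"
proof -
  have "W \<subseteq> mat_image P" if "output_nulling A B C D W" for W
    using solution_of_weakly_output_nulling[OF weakly_output_nulling_if_output_nulling[OF that]] max
    unfolding is_maximal_solution_def by blast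
  moreover have "output_nulling A B C D (mat_image P)"
    using max output_nulling_solution_image unfolding is_maximal_solution_def by blast
  ultimately show ?thesis unfolding is_Vstar_def by blast
qed

end

theorem lemma3p1:
  fixes A B C D :: "complex mat" and n p q :: nat
  assumes "A \<in> carrier_mat n n" and "B \<in> carrier_mat n q"
    and "C \<in> carrier_mat p n" and "D \<in> carrier_mat p q"
  shows "(\<exists>P H L. is_maximal_solution A B C D (P, H, L)) \<and>
    (\<forall>P H L. is_maximal_solution A B C D (P, H, L) \<longrightarrow> is_Vstar A B C D (mat_image P))"
  using ex_maximal_solution[OF assms] is_Vstar_maximal_solution_image[OF assms] by blast

end
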